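(* Let $p$ be an odd prime and $G = \langle a,b : (a[a^p,b])^p,\ b^p\rangle$. Then $G$ is a weakly para-$(C_p*C_p)$ group of Type II: writing $F=F(a,b)$, $G = F/N$ and $C_p*C_p = F/K$ with $K$ the normal closure of $\{a^p,b^p\}$, one has $N \lneq K$. In particular $G$ is not residually nilpotent.
   Context: Commutator convention: $[x,y]=x^{-1}y^{-1}xy$. $C_p$ is the cyclic group of order $p$; $C_p*C_p=\langle a,b : a^p, b^p\rangle$. Lower central series: $\gamma_1(G)=G$, $\gamma_k(G)=[G,\gamma_{k-1}(G)]$. A group $G$ is weakly para-$\Gamma$ if $G/\gamma_k(G)\cong\Gamma/\gamma_k(\Gamma)$ for all $k\ge1$. For $G=F/N$ weakly para-$\Gamma$ with $F$ free of rank $\mathrm{rk}(\Gamma)$ and $\Gamma=F/K$: $G$ is of Type I if some automorphism $\phi$ of $F$ has $\phi(N)\ge K$; of Type II if some automorphism $\phi$ of $F$ has $\phi(N)\lneq K$; of Type III otherwise. *)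

theory Defs
  imports "HOL-Algebra.Algebra" "HOL-Computational_Algebra.Primes"
begin

text \<open>A letter is (generator, inverted?): generator False = a, True = b.
  Elements of the free group are freely reduced words.\<close>

type_synonym letter = "bool \<times> bool"

fun canceling :: "letter \<Rightarrow> letter \<Rightarrow> bool" where
  "canceling (g, e) (h, f) = (g = h \<and> e \<noteq> f)"

fun reduced :: "letter list \<Rightarrow> bool" where
  "reduced [] = True"
| "reduced [x] = True"
| "reduced (x # y # ys) = (\<not> canceling x y \<and> reduced (y # ys))"

fun cons_red :: "letter \<Rightarrow> letter list \<Rightarrow> letter list" where
  "cons_red x [] = [x]"
| "cons_red x (y # ys) = (if canceling x y then ys else x # y # ys)"

definition free2 :: "letter list monoid" where
  "free2 = \<lparr> carrier = {w. reduced w}, monoid.mult = (\<lambda>x y. foldr cons_red x y), monoid.one = [] \<rparr>"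

definition gen_a :: "letter list" where "gen_a = [(False, False)]"
definition gen_b :: "letter list" where "gen_b = [(True, False)]"

definition comm :: "('a, 'b) monoid_scheme \<Rightarrow> 'a \<Rightarrow> 'a \<Rightarrow> 'a" where
  "comm G x y = inv\<^bsub>G\<^esub> x \<otimes>\<^bsub>G\<^esub> inv\<^bsub>G\<^esub> y \<otimes>\<^bsub>G\<^esub> x \<otimes>\<^bsub>G\<^esub> y"

definition normal_closure :: "('a, 'b) monoid_scheme \<Rightarrow> 'a set \<Rightarrow> 'a set" where
  "normal_closure G S =
     generate G {g \<otimes>\<^bsub>G\<^esub> s \<otimes>\<^bsub>G\<^esub> inv\<^bsub>G\<^esub> g | g s. g \<in> carrier G \<and> s \<in> S}"

text \<open>lcs0 G k = gamma_(k+1)(G).\<close>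
fun lcs0 :: "('a, 'b) monoid_scheme \<Rightarrow> nat \<Rightarrow> 'a set" where
  "lcs0 G 0 = carrier G"
| "lcs0 G (Suc k) = generate G {comm G x y | x y. x \<in> carrier G \<and> y \<in> lcs0 G k}"

text \<open>Lower central series with the paper's indexing: gamma G 1 = G,
  gamma G k = [G, gamma G (k-1)] (the value at k = 0 is irrelevant).\<close>
definition gamma :: "('a, 'b) monoid_scheme \<Rightarrow> nat \<Rightarrow> 'a set" where
  "gamma G k = lcs0 G (k - 1)"

definition weakly_para ::
  "('a, 'b) monoid_scheme \<Rightarrow> ('c, 'd) monoid_scheme \<Rightarrow> bool" where
  "weakly_para G \<Gamma> \<longleftrightarrow> (\<forall>k \<ge> 1. (G Mod gamma G k) \<cong> (\<Gamma> Mod gamma \<Gamma> k))"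

definition residually_nilpotent :: "('a, 'b) monoid_scheme \<Rightarrow> bool" where
  "residually_nilpotent G \<longleftrightarrow> (\<Inter>k\<in>{1..}. gamma G k) = {\<one>\<^bsub>G\<^esub>}"

text \<open>Type II (for G = F/N, Gamma = F/K): some automorphism phi of F has phi(N) < K.\<close>
definition type_II :: "('a, 'b) monoid_scheme \<Rightarrow> 'a set \<Rightarrow> 'a set \<Rightarrow> bool" where
  "type_II F N K \<longleftrightarrow> (\<exists>\<phi> \<in> iso F F. \<phi> ` N \<subset> K)"

end

theory Submission
  imports Defs Complex_Main
begin

text \<open>In a group with \<open>(a[a\<^sup>p,b])\<^sup>p = 1\<close>, the element \<open>a\<^sup>p\<close> sinks through the whole lower central
  series: if it lies in one term, then \<open>a[a\<^sup>p,b]\<close> and \<open>a\<close> agree modulo the next one, and taking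
  \<open>p\<close>-th powers puts \<open>a\<^sup>p\<close> there. So \<open>F/N\<close> and \<open>F/K\<close> have the same nilpotent quotients. On the other
  hand \<open>a\<^sup>p\<close> survives in \<open>F/N\<close>: send \<open>a\<close> to \<open>diag(2,1/2)\<close> in \<open>SL\<^sub>2(\<complex>)\<close> and choose the image of \<open>b\<close> such
  that it and \<open>a[a\<^sup>p,b]\<close> both get the trace \<open>\<zeta> + \<zeta>\<^sup>-\<^sup>1\<close>, where \<open>\<zeta>\<close> is a primitive \<open>p\<close>-th root of
  unity; as \<open>\<zeta> \<noteq> \<zeta>\<^sup>-\<^sup>1\<close>, this trace forces a \<open>p\<close>-th power to be trivial.\<close>

section \<open>The free group on two generators\<close>

definition inv_letter :: "letter \<Rightarrow> letter" where
  "inv_letter l = (fst l, \<not> snd l)"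

lemma canceling_iff: "canceling x y \<longleftrightarrow> y = inv_letter x"
  by (cases x; cases y) (auto simp: inv_letter_def)

lemma inv_letter_idem [simp]: "inv_letter (inv_letter x) = x"
  by (simp add: inv_letter_def)

lemma reduced_tl: "reduced (x # w) \<Longrightarrow> reduced w"
  by (cases w) auto

lemma reduced_cons_red: "reduced w \<Longrightarrow> reduced (cons_red x w)"
  by (cases w) (auto dest: reduced_tl)

lemma reduced_foldr: "reduced y \<Longrightarrow> reduced (foldr cons_red x y)"
  by (induction x) (auto intro: reduced_cons_red)

lemma cons_red_reduced: "reduced (x # w) \<Longrightarrow> cons_red x w = x # w"
  by (cases w) auto

text \<open>If \<open>x\<close> deletes the head of \<open>w\<close>, that head is
  \<open>inv_letter x\<close>; as \<open>w\<close> is reduced, it does not cancel against the next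
  letter when put back.\<close>

lemma cons_red_inv_letter: "reduced w \<Longrightarrow> cons_red (inv_letter x) (cons_red x w) = w"
proof (cases w)
  case (Cons y w')
  moreover assume "reduced w"
  ultimately show ?thesis
    using cons_red_reduced[of y w'] by (auto simp: canceling_iff)
qed (simp add: canceling_iff)

text \<open>Induction on \<open>x\<close> leaves a single letter \<open>l\<close> to move across.
  The critical case is that \<open>l\<close> deletes the head of \<open>w\<close>: on the right-hand
  side that head acts first and \<open>l\<close> then undoes it.\<close>

lemma foldr_cons_red_assoc:
  assumes "reduced z" "reduced y"
  shows "foldr cons_red (foldr cons_red x y) z = foldr cons_red x (foldr cons_red y z)"
proof (induction x)
  case (Cons l x)
  define w where "w = foldr cons_red x y"
  have "foldr cons_red (cons_red l w) z = cons_red l (foldr cons_red w z)"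
  proof (cases w)
    case (Cons m v)
    have "reduced (foldr cons_red v z)"
      by (simp add: assms reduced_foldr)
    then have "cons_red l (cons_red (inv_letter l) (foldr cons_red v z)) = foldr cons_red v z"
      using cons_red_inv_letter[of _ "inv_letter l"] by simp
    then show ?thesis
      using Cons by (auto simp: canceling_iff)
  qed simp
  then show ?case
    using Cons by (simp add: w_def)
qed simp

lemma foldr_cons_red_Nil: "reduced x \<Longrightarrow> foldr cons_red x [] = x"
proof (induction x)
  case (Cons l x)
  then show ?case
    using reduced_tl[OF Cons.prems] cons_red_reduced[OF Cons.prems] by simp
qed simp

lemma foldr_cons_red_inverse:
  assumes "reduced z"
  shows "foldr cons_red (rev (map inv_letter x)) (foldr cons_red x z) = z"
  using assms
  by (induction x arbitrary: z) (auto simp: cons_red_inv_letter reduced_foldr)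

lemma group_free2: "group free2"
proof (rule groupI)
  fix x assume x: "x \<in> carrier free2"
  \<comment> \<open>Folding the formal inverse into \<open>[]\<close> yields a reduced word, so
    \<open>v\<close> lies in the carrier by construction.\<close>
  define v where "v = foldr cons_red (rev (map inv_letter x)) []"
  have "foldr cons_red v x = foldr cons_red (rev (map inv_letter x)) (foldr cons_red [] x)"
    using x unfolding v_def by (intro foldr_cons_red_assoc) (auto simp: free2_def)
  also have "\<dots> = []"
    using foldr_cons_red_inverse[of "[]" x] x by (simp add: foldr_cons_red_Nil free2_def)
  finally show "\<exists>y\<in>carrier free2. y \<otimes>\<^bsub>free2\<^esub> x = \<one>\<^bsub>free2\<^esub>"
    by (intro bexI[of _ v]) (auto simp: free2_def v_def reduced_foldr)
qed (auto simp: free2_def reduced_foldr foldr_cons_red_assoc)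

lemma gen_in_free2 [simp]: "gen_a \<in> carrier free2" "gen_b \<in> carrier free2"
  by (auto simp: free2_def gen_a_def gen_b_def)

text \<open>Evaluation is defined on all words, reduced or not. Cancelling pairs evaluate to the
  unit, so \<open>cons_red\<close> turns into multiplication in \<open>H\<close>.\<close>

lemma free2_universal:
  assumes "group H" "x \<in> carrier H" "y \<in> carrier H"
  obtains h where "h \<in> hom free2 H" "h gen_a = x" "h gen_b = y"
proof -
  interpret H: group H by fact
  define g where "g = (\<lambda>(i, e). let u = (if i then y else x) in if e then inv\<^bsub>H\<^esub> u else u)"
  define h where "h = (\<lambda>w. foldr (\<lambda>l u. g l \<otimes>\<^bsub>H\<^esub> u) w \<one>\<^bsub>H\<^esub>)"
  have g [simp]: "g l \<in> carrier H" for l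
    using assms by (cases l) (auto simp: g_def)
  have h [simp]: "h w \<in> carrier H" for w
    by (induction w) (auto simp: h_def)
  have h_simps [simp]: "h [] = \<one>\<^bsub>H\<^esub>" "h (l # w) = g l \<otimes>\<^bsub>H\<^esub> h w" for l w
    by (simp_all add: h_def)
  have "g l \<otimes>\<^bsub>H\<^esub> g (inv_letter l) = \<one>\<^bsub>H\<^esub>" for l
    using assms by (cases l) (auto simp: g_def inv_letter_def)
  then have "g l \<otimes>\<^bsub>H\<^esub> (g (inv_letter l) \<otimes>\<^bsub>H\<^esub> u) = u" if "u \<in> carrier H" for l u
    using that by (simp add: H.m_assoc[symmetric])
  then have h_cons: "h (cons_red l w) = g l \<otimes>\<^bsub>H\<^esub> h w" for l w
    by (cases w) (auto simp: canceling_iff)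
  have "h (foldr cons_red v w) = h v \<otimes>\<^bsub>H\<^esub> h w" for v w
    by (induction v) (auto simp: h_cons H.m_assoc)
  then have "h \<in> hom free2 H"
    by (auto simp: hom_def free2_def)
  moreover have "h gen_a = x" "h gen_b = y"
    using assms by (auto simp: gen_a_def gen_b_def g_def)
  ultimately show thesis ..
qed

section \<open>Normal closures and the lower central series\<close>

lemma (in group) comm_closed [simp]: "x \<in> carrier G \<Longrightarrow> y \<in> carrier G \<Longrightarrow> comm G x y \<in> carrier G"
  by (simp add: comm_def)

lemma (in group) inv_comm:
  "x \<in> carrier G \<Longrightarrow> y \<in> carrier G \<Longrightarrow> inv (comm G x y) = comm G y x"
  by (simp add: comm_def inv_mult_group m_assoc)

lemma (in group_hom) hom_comm:
  "x \<in> carrier G \<Longrightarrow> y \<in> carrier G \<Longrightarrow> h (comm G x y) = comm H (h x) (h y)"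
  by (simp add: comm_def)

lemma (in group) conj_comm:
  assumes "g \<in> carrier G" "x \<in> carrier G" "y \<in> carrier G"
  shows "g \<otimes> comm G x y \<otimes> inv g = comm G (g \<otimes> x \<otimes> inv g) (g \<otimes> y \<otimes> inv g)"
proof -
  have c: "inv g \<otimes> (g \<otimes> z) = z" if "z \<in> carrier G" for z
    using that assms by (simp add: m_assoc[symmetric])
  show ?thesis
    using assms by (simp add: comm_def inv_mult_group m_assoc c)
qed

lemma (in group) normal_normal_closure:
  assumes "S \<subseteq> carrier G"
  shows "normal_closure G S \<lhd> G"
  unfolding normal_closure_def
proof (rule normal_generateI)
  fix h g
  assume "h \<in> {g \<otimes> s \<otimes> inv g |g s. g \<in> carrier G \<and> s \<in> S}" and g: "g \<in> carrier G"
  then obtain k s where ks: "k \<in> carrier G" "s \<in> S" "h = k \<otimes> s \<otimes> inv k"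
    by auto
  then have "s \<in> carrier G"
    using assms by auto
  then have "g \<otimes> h \<otimes> inv g = (g \<otimes> k) \<otimes> s \<otimes> inv (g \<otimes> k)"
    using g ks by (simp add: inv_mult_group m_assoc)
  then show "g \<otimes> h \<otimes> inv g \<in> {g \<otimes> s \<otimes> inv g |g s. g \<in> carrier G \<and> s \<in> S}"
    using g ks by blast
qed (use assms in auto)

lemma (in group) normal_closure_incl:
  assumes "S \<subseteq> carrier G" "s \<in> S"
  shows "s \<in> normal_closure G S"
proof -
  have "s = \<one> \<otimes> s \<otimes> inv \<one>"
    using assms by auto
  then show ?thesis
    unfolding normal_closure_def using assms(2) by (intro generate.incl) blast
qed

lemma (in group) normal_closure_minimal:
  assumes "M \<lhd> G" "S \<subseteq> M"
  shows "normal_closure G S \<subseteq> M"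
  unfolding normal_closure_def
proof (rule generate_subgroup_incl)
  show "{g \<otimes> s \<otimes> inv g |g s. g \<in> carrier G \<and> s \<in> S} \<subseteq> M"
    using assms normal.inv_op_closed2[OF assms(1)] by auto
  show "subgroup M G"
    using assms(1) by (rule normal_imp_subgroup)
qed

lemma (in group) normal_lcs0: "lcs0 G k \<lhd> G"
proof (induction k)
  case 0
  show ?case by (simp add: normal_self)
next
  case (Suc k)
  then interpret L: normal "lcs0 G k" G .
  show ?case
    unfolding lcs0.simps
  proof (rule normal_generateI)
    fix h g
    assume "h \<in> {comm G x y |x y. x \<in> carrier G \<and> y \<in> lcs0 G k}" and g: "g \<in> carrier G"
    then obtain x y where xy: "x \<in> carrier G" "y \<in> lcs0 G k" "h = comm G x y"
      by auto
    then have "g \<otimes> h \<otimes> inv g = comm G (g \<otimes> x \<otimes> inv g) (g \<otimes> y \<otimes> inv g)"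
      using g by (simp add: conj_comm)
    then show "g \<otimes> h \<otimes> inv g \<in> {comm G x y |x y. x \<in> carrier G \<and> y \<in> lcs0 G k}"
      using g xy L.inv_op_closed2 by blast
  qed auto
qed

text \<open>Surjectivity lifts the entries of every generating commutator, so inductively the
  generating set of each term maps onto that of the next group.\<close>

lemma (in group_hom) image_lcs0:
  assumes "h ` carrier G = carrier H"
  shows "h ` lcs0 G k = lcs0 H k"
proof (induction k)
  case (Suc k)
  interpret L: normal "lcs0 G k" G by (rule G.normal_lcs0)
  have "h ` {comm G x y |x y. x \<in> carrier G \<and> y \<in> lcs0 G k}
      = {comm H (h x) (h y) |x y. x \<in> carrier G \<and> y \<in> lcs0 G k}"
    by (force simp: hom_comm)
  also have "\<dots> = {comm H x y |x y. x \<in> h ` carrier G \<and> y \<in> h ` lcs0 G k}"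
    by blast
  finally have eq: "h ` {comm G x y |x y. x \<in> carrier G \<and> y \<in> lcs0 G k}
      = {comm H x y |x y. x \<in> carrier H \<and> y \<in> lcs0 H k}"
    by (simp only: Suc assms)
  have "{comm G x y |x y. x \<in> carrier G \<and> y \<in> lcs0 G k} \<subseteq> carrier G"
    by auto
  from generate_img[OF this] show ?case
    by (simp add: eq)
qed (simp add: assms)

section \<open>Quotient maps and comparison of nilpotent quotients\<close>

lemma (in normal) group_hom_Mod: "group_hom G (G Mod H) (\<lambda>x. H #> x)"
  by (simp add: group_hom_def group_hom_axioms_def factorgroup_is_group r_coset_hom_Mod is_group)

lemma (in normal) image_Mod: "(\<lambda>x. H #> x) ` carrier G = carrier (G Mod H)"
  by (auto simp: FactGroup_def RCOSETS_def)

lemma (in normal) Mod_eq_one_iff: "x \<in> carrier G \<Longrightarrow> H #> x = \<one>\<^bsub>G Mod H\<^esub> \<longleftrightarrow> x \<in> H"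
  using coset_join1[OF _ _ is_subgroup] coset_join2[OF _ is_subgroup] by (auto simp: FactGroup_def)

lemma (in group_hom) normal_vimage:
  assumes "M \<lhd> H"
  shows "{x \<in> carrier G. h x \<in> M} \<lhd> G"
proof -
  interpret M: normal M H by fact
  have "subgroup {x \<in> carrier G. h x \<in> M} G"
    by (rule subgroup.intro) auto
  then show ?thesis
    by (auto simp: G.normal_inv_iff M.inv_op_closed2)
qed

lemma (in group) pow_in_lcs0:
  fixes n :: nat
  assumes x: "x \<in> carrier G" and y: "y \<in> carrier G"
    and rel: "(x \<otimes> comm G (x [^] n) y) [^] n = \<one>"
  shows "x [^] n \<in> lcs0 G k"
proof (induction k)
  case (Suc k)
  interpret L: normal "lcs0 G (Suc k)" G by (rule normal_lcs0)
  interpret q: group_hom G "G Mod lcs0 G (Suc k)" "\<lambda>x. lcs0 G (Suc k) #> x"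
    by (rule L.group_hom_Mod)
  let ?c = "comm G (x [^] n) y"
  \<comment> \<open>The generators of \<open>lcs0\<close> carry the deep element in second place,
    while \<open>?c\<close> has it in first place; hence the detour through the inverse.\<close>
  have "comm G y (x [^] n) \<in> lcs0 G (Suc k)"
    using y Suc by (auto intro!: generate.incl)
  then have "inv (comm G y (x [^] n)) \<in> lcs0 G (Suc k)"
    by (rule L.m_inv_closed)
  then have c: "?c \<in> lcs0 G (Suc k)"
    using x y by (simp only: inv_comm nat_pow_closed)
  have "lcs0 G (Suc k) #> (x [^] n) = (lcs0 G (Suc k) #> x) [^]\<^bsub>G Mod lcs0 G (Suc k)\<^esub> n"
    using x by (rule q.hom_nat_pow)
  also have "lcs0 G (Suc k) #> x = lcs0 G (Suc k) #> (x \<otimes> ?c)"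
  proof -
    have "lcs0 G (Suc k) #> ?c = \<one>\<^bsub>G Mod lcs0 G (Suc k)\<^esub>"
      using c x y by (subst L.Mod_eq_one_iff) auto
    then show ?thesis
      using q.hom_mult[of x ?c] q.hom_closed[OF x] x y q.H.r_one by simp
  qed
  also have "(lcs0 G (Suc k) #> (x \<otimes> ?c)) [^]\<^bsub>G Mod lcs0 G (Suc k)\<^esub> n
      = lcs0 G (Suc k) #> ((x \<otimes> ?c) [^] n)"
    using x y by (intro q.hom_nat_pow[symmetric]) auto
  also have "\<dots> = \<one>\<^bsub>G Mod lcs0 G (Suc k)\<^esub>"
    unfolding rel by (rule q.hom_one)
  finally show ?case
    using x by (subst (asm) L.Mod_eq_one_iff) auto
qed (use x in simp)

text \<open>Each nilpotent quotient of \<open>G Mod N\<close> or \<open>G Mod K\<close> is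
  \<open>G\<close> modulo the preimage of a lower central term. The assumption on \<open>K\<close>
  makes the preimages for \<open>N\<close> and \<open>K\<close> coincide.\<close>

lemma (in group) weakly_para_Mod:
  assumes N: "N \<lhd> G" and K: "K \<lhd> G" and "N \<subseteq> K"
    and sub: "\<And>k x. x \<in> K \<Longrightarrow> N #> x \<in> lcs0 (G Mod N) k"
  shows "weakly_para (G Mod N) (G Mod K)"
  unfolding weakly_para_def gamma_def
proof (intro allI impI)
  fix k' :: nat
  define k where "k = k' - 1"
  \<comment> \<open>First isomorphism theorem for the composite of the two quotient maps.\<close>
  have fact: "G Mod {x \<in> carrier G. M #> x \<in> lcs0 (G Mod M) k} \<cong> (G Mod M) Mod lcs0 (G Mod M) k"
    if M: "M \<lhd> G" for M
  proof -
    interpret M: normal M G by fact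
    interpret q: group_hom G "G Mod M" "\<lambda>x. M #> x" by (rule M.group_hom_Mod)
    interpret L: normal "lcs0 (G Mod M) k" "G Mod M" by (rule q.H.normal_lcs0)
    interpret r: group_hom "G Mod M" "(G Mod M) Mod lcs0 (G Mod M) k"
        "\<lambda>x. lcs0 (G Mod M) k #>\<^bsub>G Mod M\<^esub> x"
      by (rule L.group_hom_Mod)
    let ?h = "\<lambda>x. lcs0 (G Mod M) k #>\<^bsub>G Mod M\<^esub> (M #> x)"
    have "?h \<in> hom G ((G Mod M) Mod lcs0 (G Mod M) k)"
      using Group.hom_compose[OF q.homh r.homh] by (simp add: comp_def)
    then interpret h: group_hom G "(G Mod M) Mod lcs0 (G Mod M) k" ?h
      by unfold_locales
    have "kernel G ((G Mod M) Mod lcs0 (G Mod M) k) ?h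
        = {x \<in> carrier G. M #> x \<in> lcs0 (G Mod M) k}"
      unfolding kernel_def using L.Mod_eq_one_iff[OF q.hom_closed] by blast
    moreover have "?h ` carrier G = carrier ((G Mod M) Mod lcs0 (G Mod M) k)"
      using L.image_Mod M.image_Mod by (metis image_image)
    ultimately show ?thesis
      using h.FactGroup_iso by simp
  qed
  interpret N: normal N G by fact
  interpret K: normal K G by fact
  interpret qN: group_hom G "G Mod N" "\<lambda>x. N #> x" by (rule N.group_hom_Mod)
  interpret qK: group_hom G "G Mod K" "\<lambda>x. K #> x" by (rule K.group_hom_Mod)
  interpret LG: normal "lcs0 G k" G by (rule normal_lcs0)
  interpret LN: normal "lcs0 (G Mod N) k" "G Mod N" by (rule qN.H.normal_lcs0)
  have imN: "(\<lambda>x. N #> x) ` lcs0 G k = lcs0 (G Mod N) k"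
    by (rule qN.image_lcs0[OF N.image_Mod])
  have imK: "(\<lambda>x. K #> x) ` lcs0 G k = lcs0 (G Mod K) k"
    by (rule qK.image_lcs0[OF K.image_Mod])
  have "N #> x \<in> lcs0 (G Mod N) k \<longleftrightarrow> K #> x \<in> lcs0 (G Mod K) k" if x: "x \<in> carrier G" for x
  proof
    assume "N #> x \<in> lcs0 (G Mod N) k"
    then obtain g where g: "g \<in> lcs0 G k" "N #> x = N #> g"
      using imN by (metis imageE)
    then obtain u where u: "u \<in> N" "x = u \<otimes> g"
      using rcos_self[OF x N.is_subgroup] by (auto simp: r_coset_def)
    then have "K #> x = K #> g"
      using g \<open>N \<subseteq> K\<close> by (metis K.mem_carrier K.rcos_const LG.mem_carrier coset_mult_assoc
          is_group subsetD K.subset)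
    then show "K #> x \<in> lcs0 (G Mod K) k"
      using g imK by auto
  next
    assume "K #> x \<in> lcs0 (G Mod K) k"
    then obtain g where g: "g \<in> lcs0 G k" "K #> x = K #> g"
      using imK by (metis imageE)
    then obtain u where u: "u \<in> K" "x = u \<otimes> g"
      using rcos_self[OF x K.is_subgroup] by (auto simp: r_coset_def)
    then have "N #> x = (N #> u) \<otimes>\<^bsub>G Mod N\<^esub> (N #> g)"
      using g by simp
    \<comment> \<open>The factor \<open>u\<close> may survive in \<open>G Mod N\<close>, but
      \<open>sub\<close> places its coset inside the lower central term.\<close>
    then show "N #> x \<in> lcs0 (G Mod N) k"
      using LN.m_closed[OF sub[OF u(1)] imageI[OF g(1), of "\<lambda>x. N #> x", unfolded imN]] by simp
  qed
  then have "{x \<in> carrier G. N #> x \<in> lcs0 (G Mod N) k} = {x \<in> carrier G. K #> x \<in> lcs0 (G Mod K) k}"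
    by blast
  then have *: "G Mod {x \<in> carrier G. N #> x \<in> lcs0 (G Mod N) k} \<cong> (G Mod K) Mod lcs0 (G Mod K) k"
    using fact[OF K] by simp
  interpret V: normal "{x \<in> carrier G. N #> x \<in> lcs0 (G Mod N) k}" G
    by (rule qN.normal_vimage[OF LN.normal_axioms])
  show "(G Mod N) Mod lcs0 (G Mod N) (k' - 1) \<cong> (G Mod K) Mod lcs0 (G Mod K) (k' - 1)"
    using iso_trans[OF group.iso_sym[OF V.factorgroup_is_group fact[OF N]] *]
    by (simp add: k_def)
qed

section \<open>Elements of prescribed order in $\mathrm{SL}_2$\<close>

text \<open>A quadruple lists the entries of a 2 by 2 matrix row by row.\<close>

definition sl2 :: "('a::comm_ring_1 \<times> 'a \<times> 'a \<times> 'a) monoid" where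
  "sl2 = \<lparr>carrier = {(a, b, c, d). a * d - b * c = 1},
     monoid.mult = (\<lambda>(a, b, c, d) (a', b', c', d').
       (a * a' + b * c', a * b' + b * d', c * a' + d * c', c * b' + d * d')),
     monoid.one = (1, 0, 0, 1)\<rparr>"

lemma sl2_simps [simp]:
  "(a, b, c, d) \<in> carrier sl2 \<longleftrightarrow> a * d - b * c = 1"
  "(a, b, c, d) \<otimes>\<^bsub>sl2\<^esub> (a', b', c', d') =
     (a * a' + b * c', a * b' + b * d', c * a' + d * c', c * b' + d * d')"
  "\<one>\<^bsub>sl2\<^esub> = (1, 0, 0, 1)"
  by (simp_all add: sl2_def)

lemma group_sl2: "group (sl2 :: ('a::comm_ring_1 \<times> 'a \<times> 'a \<times> 'a) monoid)"
proof (rule groupI)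
  fix x y :: "'a \<times> 'a \<times> 'a \<times> 'a"
  assume xy: "x \<in> carrier sl2" "y \<in> carrier sl2"
  obtain a b c d a' b' c' d' where eq: "x = (a, b, c, d)" "y = (a', b', c', d')"
    by (metis prod_cases4)
  show "x \<otimes>\<^bsub>sl2\<^esub> y \<in> carrier sl2"
  proof -
    have "(a * a' + b * c') * (c * b' + d * d') - (a * b' + b * d') * (c * a' + d * c')
        = (a * d - b * c) * (a' * d' - b' * c')"
      by (simp add: algebra_simps)
    then show ?thesis
      using xy by (simp add: eq)
  qed
next
  fix x :: "'a \<times> 'a \<times> 'a \<times> 'a"
  assume x: "x \<in> carrier sl2"
  obtain a b c d where eq: "x = (a, b, c, d)"
    by (metis prod_cases4)
  show "\<exists>y\<in>carrier sl2. y \<otimes>\<^bsub>sl2\<^esub> x = \<one>\<^bsub>sl2\<^esub>"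
    using x unfolding eq by (intro bexI[of _ "(d, -b, -c, a)"]) (auto simp: algebra_simps)
qed (auto simp: algebra_simps)

lemma inv_sl2:
  fixes a b c d :: "'a::comm_ring_1"
  assumes "a * d - b * c = 1"
  shows "inv\<^bsub>sl2\<^esub> (a, b, c, d) = (d, -b, -c, a)"
  using assms by (intro group.inv_equality[OF group_sl2]) (auto simp: algebra_simps)

lemma sl2_diag_pow:
  "(a, 0, 0, d) [^]\<^bsub>sl2\<^esub> n = (a ^ n, 0, 0, d ^ n)" for n :: nat
  by (induction n) (auto simp: nat_pow_def mult.commute)

text \<open>By Cayley-Hamilton, \<open>M\<^sup>m\<close> is the linear interpolation of \<open>t\<^sup>m\<close> at the eigenvalues \<open>z, z'\<close>,
  evaluated at \<open>M\<close>.\<close>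

lemma sl2_pow_eq_one:
  fixes a b c d z z' :: "'a::idom" and n :: nat
  assumes det: "a * d - b * c = 1" and tr: "a + d = z + z'" and z: "z * z' = 1"
    and "z ^ n = 1" "z \<noteq> z'"
  shows "(a, b, c, d) [^]\<^bsub>sl2\<^esub> n = \<one>\<^bsub>sl2\<^esub>"
proof -
  \<comment> \<open>With denominators cleared, the interpolation reads
    \<open>(z - z') M^m = e m M - f m I\<close> for the given matrix \<open>M\<close>, which makes
    sense in any integral domain.\<close>
  define e where "e = (\<lambda>m. z ^ m - z' ^ m)"
  define f where "f = (\<lambda>m. z ^ m * z' - z' ^ m * z)"
  have e: "e (Suc m) = (z + z') * e m - f m" for m
    by (simp add: e_def f_def algebra_simps)
  have f: "f (Suc m) = e m" for m
  proof -
    have "f (Suc m) = z ^ m * (z * z') - z' ^ m * (z * z')"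
      by (simp add: f_def ac_simps)
    then show ?thesis by (simp add: z e_def)
  qed
  have bc: "b * c = a * d - 1"
    using det by (simp add: algebra_simps)
  \<comment> \<open>Cayley-Hamilton, entry by entry: \<open>M^2 = (z + z') M - I\<close>.\<close>
  have sq: "a * a + b * c = (z + z') * a - 1" "a * b + b * d = (z + z') * b"
    "c * a + d * c = (z + z') * c" "c * b + d * d = (z + z') * d - 1"
    using bc by (simp_all add: tr[symmetric] algebra_simps)
  have *: "\<exists>a' b' c' d'. (a, b, c, d) [^]\<^bsub>sl2\<^esub> m = (a', b', c', d') \<and>
      (z - z') * a' = e m * a - f m \<and> (z - z') * b' = e m * b \<and>
      (z - z') * c' = e m * c \<and> (z - z') * d' = e m * d - f m" for m
  proof (induction m)
    case 0
    show ?case by (simp add: nat_pow_def e_def f_def)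
  next
    case (Suc m)
    then obtain a' b' c' d' where IH: "(a, b, c, d) [^]\<^bsub>sl2\<^esub> m = (a', b', c', d')"
      "(z - z') * a' = e m * a - f m" "(z - z') * b' = e m * b"
      "(z - z') * c' = e m * c" "(z - z') * d' = e m * d - f m"
      by blast
    have "(a, b, c, d) [^]\<^bsub>sl2\<^esub> Suc m =
        (a' * a + b' * c, a' * b + b' * d, c' * a + d' * c, c' * b + d' * d)"
      using IH(1) by (simp add: nat_pow_def)
    moreover have "(z - z') * (a' * a + b' * c) = e (Suc m) * a - f (Suc m)"
    proof -
      have "(z - z') * (a' * a + b' * c) = ((z - z') * a') * a + ((z - z') * b') * c"
        by (simp only: distrib_left mult.assoc)
      also have "\<dots> = e m * (a * a + b * c) - f m * a"
        unfolding IH by (simp add: algebra_simps)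
      finally show ?thesis
        unfolding sq e f by (simp add: algebra_simps)
    qed
    moreover have "(z - z') * (a' * b + b' * d) = e (Suc m) * b"
    proof -
      have "(z - z') * (a' * b + b' * d) = ((z - z') * a') * b + ((z - z') * b') * d"
        by (simp only: distrib_left mult.assoc)
      also have "\<dots> = e m * (a * b + b * d) - f m * b"
        unfolding IH by (simp add: algebra_simps)
      finally show ?thesis
        unfolding sq e by (simp add: algebra_simps)
    qed
    moreover have "(z - z') * (c' * a + d' * c) = e (Suc m) * c"
    proof -
      have "(z - z') * (c' * a + d' * c) = ((z - z') * c') * a + ((z - z') * d') * c"
        by (simp only: distrib_left mult.assoc)
      also have "\<dots> = e m * (c * a + d * c) - f m * c"
        unfolding IH by (simp add: algebra_simps)
      finally show ?thesis
        unfolding sq e by (simp add: algebra_simps)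
    qed
    moreover have "(z - z') * (c' * b + d' * d) = e (Suc m) * d - f (Suc m)"
    proof -
      have "(z - z') * (c' * b + d' * d) = ((z - z') * c') * b + ((z - z') * d') * d"
        by (simp only: distrib_left mult.assoc)
      also have "\<dots> = e m * (c * b + d * d) - f m * d"
        unfolding IH by (simp add: algebra_simps)
      finally show ?thesis
        unfolding sq e f by (simp add: algebra_simps)
    qed
    ultimately show ?case by blast
  qed
  \<comment> \<open>Both eigenvalues are \<open>n\<close>-th roots of unity, so at
    \<open>m = n\<close> the interpolation becomes \<open>(z - z') M^n = (z - z') I\<close>, and
    \<open>z - z'\<close> cancels.\<close>
  have "z' ^ n = 1"
    using z \<open>z ^ n = 1\<close> by (metis mult_1 power_mult_distrib power_one)
  then have "e n = 0" "f n = z' - z"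
    using \<open>z ^ n = 1\<close> by (simp_all add: e_def f_def)
  with *[of n] obtain a' b' c' d' where M: "(a, b, c, d) [^]\<^bsub>sl2\<^esub> n = (a', b', c', d')"
    "(z - z') * a' = (z - z') * 1" "(z - z') * b' = 0" "(z - z') * c' = 0" "(z - z') * d' = (z - z') * 1"
    by auto
  moreover have "z - z' \<noteq> 0"
    using \<open>z \<noteq> z'\<close> by simp
  ultimately have "a' = 1" "b' = 0" "c' = 0" "d' = 1"
    by (metis mult_left_cancel, metis mult_eq_0_iff, metis mult_eq_0_iff, metis mult_left_cancel)
  with M(1) show ?thesis
    by simp
qed

lemma sl2_witness:
  fixes p :: nat
  assumes "p \<ge> 3"
  obtains x y :: "complex \<times> complex \<times> complex \<times> complex"
  where "x \<in> carrier sl2" "y \<in> carrier sl2" "y [^]\<^bsub>sl2\<^esub> p = \<one>\<^bsub>sl2\<^esub>"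
    "(x \<otimes>\<^bsub>sl2\<^esub> comm sl2 (x [^]\<^bsub>sl2\<^esub> p) y) [^]\<^bsub>sl2\<^esub> p = \<one>\<^bsub>sl2\<^esub>"
    "x [^]\<^bsub>sl2\<^esub> p \<noteq> \<one>\<^bsub>sl2\<^esub>"
proof -
  interpret S: group "sl2 :: (complex \<times> complex \<times> complex \<times> complex) monoid"
    by (rule group_sl2)
  define z where "z = cis (2 * pi / p)"
  define z' where "z' = cis (- (2 * pi / p))"
  have zz: "z * z' = 1"
    by (simp add: z_def z'_def cis_mult)
  have zp: "z ^ p = 1"
    using assms by (simp add: z_def DeMoivre)
  \<comment> \<open>For \<open>p \<ge> 3\<close> the angle lies strictly between 0 and
    \<open>pi\<close>, so \<open>z\<close> and its conjugate \<open>z'\<close> differ in their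
    imaginary parts.\<close>
  have "sin (2 * pi / p) > 0"
    using assms by (intro sin_gt_zero) (auto simp: field_simps)
  then have zne: "z \<noteq> z'"
    by (auto simp: z_def z'_def complex_eq_iff)
  define q q' :: complex where "q = 2 ^ p" and "q' = (1 / 2) ^ p"
  have qq: "q * q' = 1"
    by (simp add: q_def q'_def flip: power_mult_distrib)
  \<comment> \<open>The trace of \<open>x[x^p,y]\<close> will be affine in a parameter
    \<open>s\<close>, with value \<open>T\<close> at \<open>s = 0\<close> and
    \<open>5/2 = 2 + 1/2\<close>, the trace of \<open>x\<close>, at \<open>s = 1\<close>. It can be
    prescribed freely once these values differ.\<close>
  define T where "T = q' ^ 2 * 2 + q ^ 2 / 2"
  \<comment> \<open>From \<open>2^p \<ge> 8\<close> the second summand of \<open>T\<close> is at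
    least 32, far above \<open>5/2\<close>.\<close>
  have "(2::real) ^ 3 \<le> 2 ^ p"
    using assms by (intro power_increasing) auto
  then have "(8::real) * 8 \<le> 2 ^ p * 2 ^ p"
    by (intro mult_mono) auto
  moreover have "T = complex_of_real (((1 / 2) ^ p)\<^sup>2 * 2 + (2 ^ p)\<^sup>2 / 2)"
    by (simp add: T_def q_def q'_def)
  then have "Re T = ((1 / 2) ^ p)\<^sup>2 * 2 + (2 ^ p)\<^sup>2 / 2"
    by simp
  moreover have "((1 / 2 :: real) ^ p)\<^sup>2 \<ge> 0"
    by simp
  ultimately have "Re T > 5 / 2"
    unfolding power2_eq_square by linarith
  then have T: "5 / 2 - T \<noteq> 0"
    by (auto simp: complex_eq_iff)
  \<comment> \<open>For \<open>y = (a, 1, s - 1, d)\<close> with \<open>a * d = s\<close>, the trace of \<open>x[x\<^sup>p,y]\<close> is affine in \<open>s\<close>, namely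
    \<open>s * (5/2) + (1 - s) * T\<close>; solve for the value \<open>t\<close>, then find \<open>a\<close> and \<open>d\<close> with sum \<open>t\<close> and
    product \<open>s\<close>.\<close>
  define t where "t = z + z'"
  define s where "s = (t - T) / (5 / 2 - T)"
  have s: "s * (5 / 2 - T) + T = t"
    using T by (simp add: s_def)
  define a where "a = (t + csqrt (t\<^sup>2 - 4 * s)) / 2"
  define d where "d = t - a"
  have ad: "a * d = s"
  proof -
    have "4 * (a * d) = (t + csqrt (t\<^sup>2 - 4 * s)) * (t - csqrt (t\<^sup>2 - 4 * s))"
      by (simp add: a_def d_def field_simps)
    also have "\<dots> = t\<^sup>2 - (csqrt (t\<^sup>2 - 4 * s))\<^sup>2"
      by (simp add: power2_eq_square algebra_simps)
    finally show ?thesis by simp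
  qed
  define x :: "complex \<times> complex \<times> complex \<times> complex" where "x = (2, 0, 0, 1 / 2)"
  define y :: "complex \<times> complex \<times> complex \<times> complex" where "y = (a, 1, s - 1, d)"
  have x: "x \<in> carrier sl2" and y: "y \<in> carrier sl2"
    by (simp_all add: x_def y_def ad)
  have xp: "x [^]\<^bsub>sl2\<^esub> p = (q, 0, 0, q')"
    by (simp add: x_def sl2_diag_pow q_def q'_def)
  have ixp: "inv\<^bsub>sl2\<^esub> (q, 0, 0, q') = (q', 0, 0, q)"
    using inv_sl2[of q q' 0 0] qq by simp
  have iy: "inv\<^bsub>sl2\<^esub> y = (d, -1, 1 - s, a)"
    using inv_sl2[of a d 1 "s - 1"] ad by (simp add: y_def)
  show thesis
  proof (rule that[of x y])
    show "y [^]\<^bsub>sl2\<^esub> p = \<one>\<^bsub>sl2\<^esub>"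
      unfolding y_def using ad zz zp zne
      by (intro sl2_pow_eq_one[of _ _ _ _ z z']) (auto simp: d_def t_def)
    obtain k l m n where klmn: "x \<otimes>\<^bsub>sl2\<^esub> comm sl2 (x [^]\<^bsub>sl2\<^esub> p) y = (k, l, m, n)"
      by (metis prod_cases4)
    have "k * n - l * m = 1"
      using S.m_closed[OF x S.comm_closed[OF S.nat_pow_closed[OF x] y], of p] klmn by simp
    moreover have "k + n = z + z'"
    proof -
      have kn: "k = 2 * q' * (q * s + q' * (1 - s))" "n = q / 2 * (q * (1 - s) + q' * s)"
        using klmn ad unfolding xp comm_def ixp iy
        by (auto simp: x_def y_def field_simps)
      have "k + n = s * (q * q') * (5 / 2) + (1 - s) * T"
        unfolding kn T_def by (simp add: power2_eq_square field_simps)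
      also have "\<dots> = t"
        using s qq by (simp add: algebra_simps)
      finally show ?thesis by (simp add: t_def)
    qed
    ultimately show "(x \<otimes>\<^bsub>sl2\<^esub> comm sl2 (x [^]\<^bsub>sl2\<^esub> p) y) [^]\<^bsub>sl2\<^esub> p = \<one>\<^bsub>sl2\<^esub>"
      unfolding klmn using zz zp zne by (intro sl2_pow_eq_one) auto
    \<comment> \<open>The bound on \<open>Re T\<close> is reused: \<open>q = 1\<close> forces
      \<open>q' = 1\<close> and hence \<open>T = 5/2\<close>.\<close>
    have "q \<noteq> 1"
    proof
      assume "q = 1"
      then have "Re T = 5 / 2"
        using qq by (simp add: T_def)
      with \<open>Re T > 5 / 2\<close> show False by simp
    qed
    then show "x [^]\<^bsub>sl2\<^esub> p \<noteq> \<one>\<^bsub>sl2\<^esub>"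
      by (simp add: xp)
  qed (fact x y)+
qed

section \<open>The presentation with relators \<open>(a[a^p,b])^p\<close> and
  \<open>b^p\<close>\<close>

theorem mainTheorem9:
  fixes p :: nat
  assumes "Factorial_Ring.prime p" and "odd p"
  defines "N \<equiv> normal_closure free2
             {(gen_a \<otimes>\<^bsub>free2\<^esub> comm free2 (gen_a [^]\<^bsub>free2\<^esub> p) gen_b) [^]\<^bsub>free2\<^esub> p,
              gen_b [^]\<^bsub>free2\<^esub> p}"
      and "K \<equiv> normal_closure free2 {gen_a [^]\<^bsub>free2\<^esub> p, gen_b [^]\<^bsub>free2\<^esub> p}"
  shows "weakly_para (free2 Mod N) (free2 Mod K)
       \<and> type_II free2 N K
       \<and> N \<subset> K
       \<and> \<not> residually_nilpotent (free2 Mod N)"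
proof -
  interpret F: group free2 by (rule group_free2)
  let ?a = "gen_a [^]\<^bsub>free2\<^esub> p" and ?b = "gen_b [^]\<^bsub>free2\<^esub> p"
  let ?r = "(gen_a \<otimes>\<^bsub>free2\<^esub> comm free2 ?a gen_b) [^]\<^bsub>free2\<^esub> p"
  have relK: "{?a, ?b} \<subseteq> carrier free2" and relN: "{?r, ?b} \<subseteq> carrier free2"
    by auto
  have nK: "K \<lhd> free2" and nN: "N \<lhd> free2"
    unfolding K_def N_def using relK relN by (auto intro: F.normal_normal_closure)
  interpret K: normal K free2 by fact
  interpret N: normal N free2 by fact
  interpret qK: group_hom free2 "free2 Mod K" "\<lambda>x. K #>\<^bsub>free2\<^esub> x" by (rule K.group_hom_Mod)
  interpret qN: group_hom free2 "free2 Mod N" "\<lambda>x. N #>\<^bsub>free2\<^esub> x" by (rule N.group_hom_Mod)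
  have aK: "?a \<in> K" and bK: "?b \<in> K" and rN: "?r \<in> N" and bN: "?b \<in> N"
    unfolding K_def N_def using relK relN by (auto intro: F.normal_closure_incl)

  \<comment> \<open>The commutator is a product of the inverse of \<open>?a\<close> and a conjugate
    of \<open>?a\<close>, so it dies modulo \<open>K\<close>; there \<open>?r\<close> reduces to
    \<open>?a\<close>, which dies too. This gives \<open>N \<subseteq> K\<close>.\<close>
  have "comm free2 ?a gen_b = inv\<^bsub>free2\<^esub> ?a \<otimes>\<^bsub>free2\<^esub> (inv\<^bsub>free2\<^esub> gen_b \<otimes>\<^bsub>free2\<^esub> ?a \<otimes>\<^bsub>free2\<^esub> gen_b)"
    by (simp add: comm_def F.m_assoc)
  then have "comm free2 ?a gen_b \<in> K"
    using aK K.inv_op_closed1[of gen_b ?a] by simp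
  then have "K #>\<^bsub>free2\<^esub> comm free2 ?a gen_b = \<one>\<^bsub>free2 Mod K\<^esub>"
    by (subst K.Mod_eq_one_iff) simp_all
  then have "K #>\<^bsub>free2\<^esub> (gen_a \<otimes>\<^bsub>free2\<^esub> comm free2 ?a gen_b) = K #>\<^bsub>free2\<^esub> gen_a"
    using qK.hom_mult[of gen_a "comm free2 ?a gen_b"] qK.hom_closed[of gen_a] qK.H.r_one by simp
  then have "K #>\<^bsub>free2\<^esub> ?r = K #>\<^bsub>free2\<^esub> ?a"
    by (simp add: qK.hom_nat_pow)
  also have "\<dots> = \<one>\<^bsub>free2 Mod K\<^esub>"
    using aK by (subst K.Mod_eq_one_iff) simp_all
  finally have "?r \<in> K"
    by (subst (asm) K.Mod_eq_one_iff) simp_all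
  then have NK: "N \<subseteq> K"
    unfolding N_def using nK bK by (intro F.normal_closure_minimal) auto

  have "?a \<notin> N"
  proof
    assume "?a \<in> N"
    \<comment> \<open>Oddness excludes \<open>p = 2\<close>, where both eigenvalues would be
      -1.\<close>
    have "p \<ge> 3"
      using \<open>odd p\<close> prime_ge_2_nat[OF assms(1)] by (cases "p = 2") auto
    then obtain x y :: "complex \<times> complex \<times> complex \<times> complex"
      where xy: "x \<in> carrier sl2" "y \<in> carrier sl2" "y [^]\<^bsub>sl2\<^esub> p = \<one>\<^bsub>sl2\<^esub>"
        "(x \<otimes>\<^bsub>sl2\<^esub> comm sl2 (x [^]\<^bsub>sl2\<^esub> p) y) [^]\<^bsub>sl2\<^esub> p = \<one>\<^bsub>sl2\<^esub>"
        "x [^]\<^bsub>sl2\<^esub> p \<noteq> \<one>\<^bsub>sl2\<^esub>"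
      by (rule sl2_witness)
    obtain h where h: "h \<in> hom free2 sl2" "h gen_a = x" "h gen_b = y"
      using free2_universal[OF group_sl2 xy(1,2)] .
    interpret h: group_hom free2 sl2 h
      using h group_sl2 by (simp add: group_hom_def group_hom_axioms_def group_free2)
    \<comment> \<open>Both relators are killed by \<open>h\<close>, so \<open>h\<close> kills
      \<open>N\<close> and would kill \<open>?a\<close>, although \<open>x^p\<close> is
      nontrivial.\<close>
    have "{?r, ?b} \<subseteq> kernel free2 sl2 h"
      using xy h by (auto simp: kernel_def h.hom_nat_pow h.hom_comm simp del: sl2_simps)
    then have "N \<subseteq> kernel free2 sl2 h"
      unfolding N_def by (intro F.normal_closure_minimal h.normal_kernel)
    with \<open>?a \<in> N\<close> have "h ?a = \<one>\<^bsub>sl2\<^esub>"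
      by (auto simp: kernel_def simp del: sl2_simps)
    then show False
      using xy(5) h by (simp add: h.hom_nat_pow del: sl2_simps)
  qed
  with aK NK have NK': "N \<subset> K"
    by blast

  \<comment> \<open>The relator is rewritten inside \<open>free2 Mod N\<close> to match the
    hypothesis of \<open>pow_in_lcs0\<close>.\<close>
  have "((N #>\<^bsub>free2\<^esub> gen_a) \<otimes>\<^bsub>free2 Mod N\<^esub> comm (free2 Mod N)
      ((N #>\<^bsub>free2\<^esub> gen_a) [^]\<^bsub>free2 Mod N\<^esub> p) (N #>\<^bsub>free2\<^esub> gen_b)) [^]\<^bsub>free2 Mod N\<^esub> p
      = N #>\<^bsub>free2\<^esub> ?r"
    by (simp only: qN.hom_nat_pow qN.hom_comm qN.hom_mult gen_in_free2 F.nat_pow_closed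
        F.comm_closed F.m_closed)
  also have "\<dots> = \<one>\<^bsub>free2 Mod N\<^esub>"
    using rN by (subst N.Mod_eq_one_iff) simp_all
  finally have aL: "N #>\<^bsub>free2\<^esub> ?a \<in> lcs0 (free2 Mod N) k" for k
    using qN.H.pow_in_lcs0[of "N #>\<^bsub>free2\<^esub> gen_a" "N #>\<^bsub>free2\<^esub> gen_b" p k]
    by (simp only: qN.hom_nat_pow qN.hom_closed gen_in_free2)

  have "weakly_para (free2 Mod N) (free2 Mod K)"
  proof (rule F.weakly_para_Mod[OF nN nK NK])
    fix k x assume "x \<in> K"
    interpret L: normal "lcs0 (free2 Mod N) k" "free2 Mod N" by (rule qN.H.normal_lcs0)
    have "N #>\<^bsub>free2\<^esub> ?b = \<one>\<^bsub>free2 Mod N\<^esub>"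
      using bN by (subst N.Mod_eq_one_iff) simp_all
    then have "N #>\<^bsub>free2\<^esub> ?b \<in> lcs0 (free2 Mod N) k"
      using L.one_closed by simp
    \<comment> \<open>The preimage of a lower central term is normal and contains both normal
      generators of \<open>K\<close>, hence all of \<open>K\<close>.\<close>
    then have "K \<subseteq> {x \<in> carrier free2. N #>\<^bsub>free2\<^esub> x \<in> lcs0 (free2 Mod N) k}"
      unfolding K_def using aL[of k]
      by (intro F.normal_closure_minimal qN.normal_vimage[OF L.normal_axioms]) auto
    with \<open>x \<in> K\<close> show "N #>\<^bsub>free2\<^esub> x \<in> lcs0 (free2 Mod N) k"
      by blast
  qed
  \<comment> \<open>The identity automorphism is the witness, since \<open>N\<close> is already
    properly contained in \<open>K\<close>.\<close>
  moreover have "type_II free2 N K"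
    unfolding type_II_def using NK' by (intro bexI[OF _ iso_set_refl]) simp
  moreover have "\<not> residually_nilpotent (free2 Mod N)"
  proof
    assume "residually_nilpotent (free2 Mod N)"
    \<comment> \<open>The coset of \<open>?a\<close> lies in every term of the series, yet it is
      nontrivial by the matrix representation.\<close>
    moreover have "N #>\<^bsub>free2\<^esub> ?a \<in> (\<Inter>k\<in>{1..}. gamma (free2 Mod N) k)"
      using aL by (simp add: gamma_def)
    ultimately have "N #>\<^bsub>free2\<^esub> ?a = \<one>\<^bsub>free2 Mod N\<^esub>"
      unfolding residually_nilpotent_def by blast
    then show False
      using \<open>?a \<notin> N\<close> by (subst (asm) N.Mod_eq_one_iff) simp_all
  qed
  ultimately show ?thesis
    using NK' by blast
qed

end
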